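(* For each set $X$ and each subgroup $G$ of the symmetric group $S(X)$ with $S_\omega(X)\subset G$, the topology $\mathcal T_p$ of pointwise convergence on $G$ is the coarsest $T_1$-topology turning $G$ into a [semi]-topological group. That is, $\mathcal T_p$ is a $T_1$-topology turning $G$ into a [semi]-topological group, and $\mathcal T_p\subset\mathcal T$ for every $T_1$-topology $\mathcal T$ on $G$ such that $(G,\mathcal T)$ is a [semi]-topological group.
   Context: $S(X)$ is the group of all bijections of $X$ under composition; $S_\omega(X)\subset S(X)$ is the subgroup of permutations $f$ with finite support $\{x\in X:f(x)\ne x\}$. $\mathcal T_p$ on $G$ is the subspace topology inherited from the Tychonoff power $X^X$ where $X$ is discrete. A group $G$ endowed with a topology is a [semi]-topological group if the functions $G\times G\to G$, $(x,y)\mapsto xy$, and $G\times G\to G$, $(x,y)\mapsto xyx^{-1}y^{-1}$, are separately continuous (continuous in each variable when the other is fixed). *)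

theory Defs
  imports "HOL-Analysis.Analysis" "HOL-Algebra.Bij"
begin

text \<open>The symmetric group \<open>S(X)\<close> is \<^const>\<open>BijGroup\<close>: its elements are the extensional
  functions (value \<open>undefined\<close> outside \<open>X\<close>) that are bijections of \<open>X\<close>, multiplied by composition.
  The same extensional functions are the points of the product topology indexed by \<open>X\<close>.\<close>

definition finitary_perms :: "'a set \<Rightarrow> ('a \<Rightarrow> 'a) set" where
  "finitary_perms X = {f \<in> carrier (BijGroup X). finite {x \<in> X. f x \<noteq> x}}"

definition pointwise_topology :: "'a set \<Rightarrow> ('a \<Rightarrow> 'a) set \<Rightarrow> ('a \<Rightarrow> 'a) topology" where
  "pointwise_topology X G = subtopology (product_topology (\<lambda>_. discrete_topology X) X) G"

definition separately_continuous ::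
    "'a topology \<Rightarrow> 'b topology \<Rightarrow> 'c topology \<Rightarrow> ('a \<Rightarrow> 'b \<Rightarrow> 'c) \<Rightarrow> bool" where
  "separately_continuous S T U f \<longleftrightarrow>
     (\<forall>y \<in> topspace T. continuous_map S U (\<lambda>x. f x y)) \<and>
     (\<forall>x \<in> topspace S. continuous_map T U (\<lambda>y. f x y))"

text \<open>The bracketed prefix in ``[semi]-topological'' is part of the name: the brackets refer to
  the commutator. Continuity of the inversion is not required.\<close>

definition bracket_semi_topological_group :: "('a, 'b) monoid_scheme \<Rightarrow> 'a topology \<Rightarrow> bool" where
  "bracket_semi_topological_group G T \<longleftrightarrow>
     group G \<and> topspace T = carrier G \<and>
     separately_continuous T T T (\<lambda>x y. x \<otimes>\<^bsub>G\<^esub> y) \<and>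
     separately_continuous T T T
       (\<lambda>x y. x \<otimes>\<^bsub>G\<^esub> y \<otimes>\<^bsub>G\<^esub> inv\<^bsub>G\<^esub> x \<otimes>\<^bsub>G\<^esub> inv\<^bsub>G\<^esub> y)"

end

theory Submission
  imports Defs
begin

text \<open>Translations of a [semi]-topological group are homeomorphisms, and conjugation
  \<open>g \<mapsto> g a g\<^sup>-\<^sup>1\<close> of a fixed element is continuous. Composing two such maps, the set of all \<open>g\<close>
  for which \<open>g a g\<^sup>-\<^sup>1\<close> does not commute with \<open>b\<close> is open in every \<open>T\<^sub>1\<close> topology. For \<open>a\<close> and \<open>b\<close>
  the transpositions of \<open>x\<close> with \<open>z\<close> and of \<open>x\<close> with \<open>y\<close> this condition says that \<open>{g x, g z}\<close> meets
  \<open>{x, y}\<close> in exactly one point. Imposing it for two values of \<open>z\<close> and two values of \<open>y\<close> forces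
  \<open>g x = x\<close>, so stabilizers of points are open. This needs five points; if \<open>X\<close> is finite, every
  \<open>T\<^sub>1\<close> topology on \<open>G\<close> is discrete anyway.\<close>

section \<open>Bracket semitopological groups\<close>

text \<open>Closure of the continuous self-maps under pointwise products, rather than separate
  continuity, lets the commutator be treated as a word: it is assembled from the identity map,
  constants and inversion.\<close>

lemma bracket_semi_topological_groupI:
  assumes "group H" and "topspace T = carrier H"
    and mult: "\<And>p q. continuous_map T T p \<Longrightarrow> continuous_map T T q \<Longrightarrow>
      continuous_map T T (\<lambda>g. p g \<otimes>\<^bsub>H\<^esub> q g)"
    and inv: "continuous_map T T (\<lambda>g. inv\<^bsub>H\<^esub> g)"
  shows "bracket_semi_topological_group H T"
proof -
  interpret group H by fact
  have const: "continuous_map T T (\<lambda>_. c)" if "c \<in> carrier H" for c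
    using that assms(2) by simp
  have id: "continuous_map T T (\<lambda>g. g)"
    by simp
  show ?thesis
    unfolding bracket_semi_topological_group_def separately_continuous_def
    using assms(1,2) by (auto intro!: mult const id inv)
qed

text \<open>The commutator of \<open>g\<close> with \<open>a\<close> is the conjugate
  \<open>g a g^-1\<close> times \<open>a^-1\<close>, and right translation by \<open>a\<close>
  cancels the last factor.\<close>

lemma bracket_semi_topological_group_continuous_conjugation:
  assumes T: "bracket_semi_topological_group H T" and a: "a \<in> carrier H"
  shows "continuous_map T T (\<lambda>g. g \<otimes>\<^bsub>H\<^esub> a \<otimes>\<^bsub>H\<^esub> inv\<^bsub>H\<^esub> g)"
proof -
  interpret group H using T by (simp add: bracket_semi_topological_group_def)
  have top: "topspace T = carrier H"
    using T by (simp add: bracket_semi_topological_group_def)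
  have "continuous_map T T (\<lambda>g. g \<otimes>\<^bsub>H\<^esub> a \<otimes>\<^bsub>H\<^esub> inv\<^bsub>H\<^esub> g \<otimes>\<^bsub>H\<^esub> inv\<^bsub>H\<^esub> a)"
    and "continuous_map T T (\<lambda>g. g \<otimes>\<^bsub>H\<^esub> a)"
    using T a by (auto simp: bracket_semi_topological_group_def separately_continuous_def)
  then have "continuous_map T T
      ((\<lambda>g. g \<otimes>\<^bsub>H\<^esub> a) \<circ> (\<lambda>g. g \<otimes>\<^bsub>H\<^esub> a \<otimes>\<^bsub>H\<^esub> inv\<^bsub>H\<^esub> g \<otimes>\<^bsub>H\<^esub> inv\<^bsub>H\<^esub> a))"
    by (rule continuous_map_compose)
  then show ?thesis
    by (rule continuous_map_eq) (use a top in \<open>simp add: m_assoc\<close>)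
qed

text \<open>Commuting with \<open>b\<close> is rewritten as an equation with a fixed right-hand
  side: \<open>c\<close> commutes with \<open>b\<close> iff \<open>c b c^-1 = b\<close>. The set is
  therefore the preimage of the complement of the point \<open>b\<close>, which is open by the T1
  axiom.\<close>

lemma openin_conjugate_not_commuting:
  assumes T: "bracket_semi_topological_group H T" "t1_space T"
    and a: "a \<in> carrier H" and b: "b \<in> carrier H"
  shows "openin T {g \<in> carrier H. g \<otimes>\<^bsub>H\<^esub> a \<otimes>\<^bsub>H\<^esub> inv\<^bsub>H\<^esub> g \<otimes>\<^bsub>H\<^esub> b \<noteq> b \<otimes>\<^bsub>H\<^esub> (g \<otimes>\<^bsub>H\<^esub> a \<otimes>\<^bsub>H\<^esub> inv\<^bsub>H\<^esub> g)}"
proof -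
  interpret group H using T by (simp add: bracket_semi_topological_group_def)
  have top: "topspace T = carrier H"
    using T by (simp add: bracket_semi_topological_group_def)
  let ?c = "\<lambda>a g. g \<otimes>\<^bsub>H\<^esub> a \<otimes>\<^bsub>H\<^esub> inv\<^bsub>H\<^esub> g"
  have cont: "continuous_map T T (?c b \<circ> ?c a)"
    by (intro continuous_map_compose[of _ T]
        bracket_semi_topological_group_continuous_conjugation T a b)
  have "openin T (topspace T - {b})"
    using T(2) b top by (intro openin_diff openin_topspace) (simp add: t1_space_closedin_singleton)
  from openin_continuous_map_preimage[OF cont this]
  have "openin T {g \<in> topspace T. (?c b \<circ> ?c a) g \<in> topspace T - {b}}" .
  moreover have "?c b c = b \<longleftrightarrow> c \<otimes>\<^bsub>H\<^esub> b = b \<otimes>\<^bsub>H\<^esub> c" if "c \<in> carrier H" for c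
    using that b by (metis inv_solve_right' m_closed)
  ultimately show ?thesis
    using a b top by (auto elim!: back_subst[of "openin T"])
qed

text \<open>The translate of \<open>W\<close> by \<open>g\<close> is the preimage of
  \<open>W\<close> under left translation by the inverse of \<open>g\<close>.\<close>

lemma bracket_semi_topological_group_openin_left_coset:
  assumes T: "bracket_semi_topological_group H T"
    and W: "openin T W" and g: "g \<in> carrier H"
  shows "openin T ((\<lambda>h. g \<otimes>\<^bsub>H\<^esub> h) ` W)"
proof -
  interpret group H using T by (simp add: bracket_semi_topological_group_def)
  have top: "topspace T = carrier H"
    using T by (simp add: bracket_semi_topological_group_def)
  have "continuous_map T T (\<lambda>h. inv\<^bsub>H\<^esub> g \<otimes>\<^bsub>H\<^esub> h)"
    using T g by (auto simp: bracket_semi_topological_group_def separately_continuous_def)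
  from openin_continuous_map_preimage[OF this W]
  have "openin T {h \<in> carrier H. inv\<^bsub>H\<^esub> g \<otimes>\<^bsub>H\<^esub> h \<in> W}" using top by simp
  moreover have "{h \<in> carrier H. inv\<^bsub>H\<^esub> g \<otimes>\<^bsub>H\<^esub> h \<in> W} = (\<lambda>h. g \<otimes>\<^bsub>H\<^esub> h) ` W"
  proof (intro equalityI subsetI)
    fix h assume "h \<in> {h \<in> carrier H. inv\<^bsub>H\<^esub> g \<otimes>\<^bsub>H\<^esub> h \<in> W}"
    then show "h \<in> (\<lambda>h. g \<otimes>\<^bsub>H\<^esub> h) ` W"
      using g by (intro image_eqI[of _ _ "inv\<^bsub>H\<^esub> g \<otimes>\<^bsub>H\<^esub> h"]) (auto simp: m_assoc[symmetric])
  next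
    fix h assume "h \<in> (\<lambda>h. g \<otimes>\<^bsub>H\<^esub> h) ` W"
    then show "h \<in> {h \<in> carrier H. inv\<^bsub>H\<^esub> g \<otimes>\<^bsub>H\<^esub> h \<in> W}"
      using g openin_subset[OF W] top by (auto simp: m_assoc[symmetric] subset_iff)
  qed
  ultimately show ?thesis by simp
qed

section \<open>The topology of pointwise convergence\<close>

text \<open>Every preimage is a union of fibres, so open fibres suffice.\<close>

lemma continuous_map_into_discrete_topology:
  "continuous_map S (discrete_topology D) f \<longleftrightarrow>
     f \<in> topspace S \<rightarrow> D \<and> (\<forall>y\<in>D. openin S {s \<in> topspace S. f s = y})"
proof (intro iffI conjI)
  assume R: "f \<in> topspace S \<rightarrow> D \<and> (\<forall>y\<in>D. openin S {s \<in> topspace S. f s = y})"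
  have "openin S {s \<in> topspace S. f s \<in> U}" if "U \<subseteq> D" for U
  proof -
    have "{s \<in> topspace S. f s \<in> U} = (\<Union>y\<in>U. {s \<in> topspace S. f s = y})" by auto
    then show ?thesis using R that by (auto simp: subset_iff intro!: openin_Union)
  qed
  then show "continuous_map S (discrete_topology D) f"
    using R by (auto simp: continuous_map)
next
  assume L: "continuous_map S (discrete_topology D) f"
  then show "f \<in> topspace S \<rightarrow> D"
    using continuous_map_funspace by fastforce
  show "\<forall>y\<in>D. openin S {s \<in> topspace S. f s = y}"
    using openin_continuous_map_preimage[OF L, of "{_}"] by simp
qed

lemma BijGroup_apply:
  assumes "g \<in> carrier (BijGroup X)" "h \<in> carrier (BijGroup X)" "x \<in> X"
  shows "(g \<otimes>\<^bsub>BijGroup X\<^esub> h) x = g (h x)"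
  using assms by (simp add: BijGroup_def compose_def)

lemma BijGroup_carrier_bij_betw: "g \<in> carrier (BijGroup X) \<Longrightarrow> bij_betw g X X"
  by (simp add: BijGroup_def Bij_def)

lemma BijGroup_carrier_mem: "g \<in> carrier (BijGroup X) \<Longrightarrow> x \<in> X \<Longrightarrow> g x \<in> X"
  using BijGroup_carrier_bij_betw bij_betwE by metis

text \<open>Exchanging argument and value turns the fibres of inversion into fibres of evaluation,
  which makes inversion continuous for pointwise convergence.\<close>

lemma BijGroup_inv_apply_eq_iff:
  assumes "g \<in> carrier (BijGroup X)" "x \<in> X" "y \<in> X"
  shows "(inv\<^bsub>BijGroup X\<^esub> g) x = y \<longleftrightarrow> g y = x"
proof -
  have b: "bij_betw g X X" using assms BijGroup_carrier_bij_betw by blast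
  have "(inv\<^bsub>BijGroup X\<^esub> g) x = inv_into X g x"
    using assms(1,2) inv_BijGroup[of g X] by (simp add: BijGroup_def)
  then show ?thesis
    using b assms by (metis bij_betw_inv_into_left bij_betw_inv_into_right)
qed

lemma BijGroup_carrier_subset_PiE: "carrier (BijGroup X) \<subseteq> (\<Pi>\<^sub>E x\<in>X. X)"
proof
  fix g assume g: "g \<in> carrier (BijGroup X)"
  then have "g \<in> extensional X" by (simp add: BijGroup_def Bij_def)
  then show "g \<in> (\<Pi>\<^sub>E x\<in>X. X)"
    using BijGroup_carrier_mem[OF g] by (simp add: PiE_iff)
qed

lemma topspace_pointwise_topology:
  assumes "G \<subseteq> carrier (BijGroup X)"
  shows "topspace (pointwise_topology X G) = G"
  using subset_trans[OF assms BijGroup_carrier_subset_PiE]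
  by (simp add: pointwise_topology_def Int_absorb1)

text \<open>Continuity into a subspace of a product is continuity of every coordinate, here with
  values in a discrete space. The criterion serves twice: for the group operations, and for the
  comparison with an arbitrary topology \<open>T\<close>.\<close>

lemma continuous_map_into_pointwise_topology:
  assumes G: "G \<subseteq> carrier (BijGroup X)"
  shows "continuous_map S (pointwise_topology X G) f \<longleftrightarrow>
    f \<in> topspace S \<rightarrow> G \<and>
    (\<forall>x\<in>X. \<forall>y\<in>X. openin S {s \<in> topspace S. f s x = y})"
proof -
  have "f ` topspace S \<subseteq> extensional X" and "\<forall>x\<in>X. (\<lambda>s. f s x) \<in> topspace S \<rightarrow> X"
    if "f \<in> topspace S \<rightarrow> G"
    using subset_trans[OF G BijGroup_carrier_subset_PiE] that
    by (auto simp: PiE_iff Pi_iff subset_iff)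
  then show ?thesis
    unfolding pointwise_topology_def continuous_map_in_subtopology
      continuous_map_componentwise continuous_map_into_discrete_topology
    by blast
qed

lemma t1_space_pointwise_topology: "t1_space (pointwise_topology X G)"
  unfolding pointwise_topology_def
  by (intro t1_space_subtopology) (simp add: t1_space_product_topology Hausdorff_imp_t1_space)

lemma bracket_semi_topological_group_pointwise_topology:
  assumes G: "subgroup G (BijGroup X)"
  shows "bracket_semi_topological_group (BijGroup X\<lparr>carrier := G\<rparr>) (pointwise_topology X G)"
proof -
  interpret B: group "BijGroup X" by (rule group_BijGroup)
  have sub: "G \<subseteq> carrier (BijGroup X)" using G by (rule subgroup.subset)
  let ?T = "pointwise_topology X G"
  have top: "topspace ?T = G" by (rule topspace_pointwise_topology[OF sub])
  have iff: "continuous_map ?T ?T f \<longleftrightarrow>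
      f \<in> G \<rightarrow> G \<and> (\<forall>x\<in>X. \<forall>y\<in>X. openin ?T {g \<in> G. f g x = y})" for f
    by (simp add: continuous_map_into_pointwise_topology[OF sub] top)
  have inv_eq: "inv\<^bsub>BijGroup X\<lparr>carrier := G\<rparr>\<^esub> g = inv\<^bsub>BijGroup X\<^esub> g" if "g \<in> G" for g
    using B.m_inv_consistent[OF G that] .
  show ?thesis
  proof (rule bracket_semi_topological_groupI)
    show "group (BijGroup X\<lparr>carrier := G\<rparr>)"
      using B.subgroup_imp_group[OF G] .
  next
    fix p q assume pq: "continuous_map ?T ?T p" "continuous_map ?T ?T q"
    note pq = iff[THEN iffD1, OF pq(1)] iff[THEN iffD1, OF pq(2)]
    have mem: "p g \<in> G" "q g \<in> G" if "g \<in> G" for g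
      using pq that by auto
    have "openin ?T {g \<in> G. (p g \<otimes>\<^bsub>BijGroup X\<^esub> q g) x = y}" if "x \<in> X" "y \<in> X" for x y
    proof -
      have "(p g \<otimes>\<^bsub>BijGroup X\<^esub> q g) x = p g (q g x)" "q g x \<in> X" if "g \<in> G" for g
        using mem[OF that] sub \<open>x \<in> X\<close>
        by (metis BijGroup_apply subsetD, metis BijGroup_carrier_mem subsetD)
      \<comment> \<open>Splitting by the intermediate value \<open>z = q g x\<close> leaves a union
        of intersections of two open fibres.\<close>
      then have "{g \<in> G. (p g \<otimes>\<^bsub>BijGroup X\<^esub> q g) x = y} =
          (\<Union>z\<in>X. {g \<in> G. q g x = z} \<inter> {g \<in> G. p g z = y})"
        by auto
      then show ?thesis
        using pq that by (auto intro!: openin_Union openin_Int)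
    qed
    then show "continuous_map ?T ?T (\<lambda>g. p g \<otimes>\<^bsub>BijGroup X\<lparr>carrier := G\<rparr>\<^esub> q g)"
      unfolding iff using mem subgroup.m_closed[OF G] by simp
  next
    have id: "continuous_map ?T ?T (\<lambda>g. g)"
      by simp
    have "{g \<in> G. (inv\<^bsub>BijGroup X\<lparr>carrier := G\<rparr>\<^esub> g) x = y} = {g \<in> G. g y = x}"
      if "x \<in> X" "y \<in> X" for x y
      using that sub BijGroup_inv_apply_eq_iff[OF _ that]
      by (intro Collect_cong conj_cong) (simp_all add: inv_eq subset_iff)
    then show "continuous_map ?T ?T (\<lambda>g. inv\<^bsub>BijGroup X\<lparr>carrier := G\<rparr>\<^esub> g)"
      using id subgroup.m_inv_closed[OF G] unfolding iff by (auto simp: inv_eq)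
  qed (simp add: top)
qed

section \<open>Transpositions and the openness of stabilizers\<close>

text \<open>Restricting to \<open>X\<close> gives the value \<open>undefined\<close> elsewhere, as
  membership in \<open>BijGroup X\<close> demands. For \<open>a = b\<close> this is the identity of
  the group.\<close>

definition transposition_on :: "'a set \<Rightarrow> 'a \<Rightarrow> 'a \<Rightarrow> 'a \<Rightarrow> 'a" where
  "transposition_on X a b = restrict (Transposition.transpose a b) X"

lemma transposition_on_apply: "x \<in> X \<Longrightarrow> transposition_on X a b x = Transposition.transpose a b x"
  by (simp add: transposition_on_def)

lemma transposition_on_finitary:
  assumes "a \<in> X" "b \<in> X"
  shows "transposition_on X a b \<in> finitary_perms X"
proof -
  have "bij_betw (Transposition.transpose a b) X X"
    using assms by (intro bij_betwI[where g = "Transposition.transpose a b"]) (auto simp: Transposition.transpose_def)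
  moreover have "{x \<in> X. transposition_on X a b x \<noteq> x} \<subseteq> {a, b}"
    by (auto simp: transposition_on_apply Transposition.transpose_def split: if_splits)
  then have "finite {x \<in> X. transposition_on X a b x \<noteq> x}"
    by (rule finite_subset) simp
  ultimately show ?thesis
    by (simp add: finitary_perms_def BijGroup_def Bij_def transposition_on_def)
qed

lemma BijGroup_carrier_eqI:
  assumes "g \<in> carrier (BijGroup X)" "h \<in> carrier (BijGroup X)" "\<And>x. x \<in> X \<Longrightarrow> g x = h x"
  shows "g = h"
  using assms by (auto simp: BijGroup_def Bij_def intro: extensionalityI)

text \<open>Disjoint pairs move different points, and equal pairs give the same permutation. Its
  contrapositive extracts from non-commutation that the two pairs meet but do not coincide.\<close>

lemma transposition_on_commute:
  assumes "a \<in> X" "b \<in> X" "c \<in> X" "d \<in> X" and "{a, b} \<inter> {c, d} = {} \<or> {a, b} = {c, d}"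
  shows "transposition_on X a b \<otimes>\<^bsub>BijGroup X\<^esub> transposition_on X c d =
    transposition_on X c d \<otimes>\<^bsub>BijGroup X\<^esub> transposition_on X a b"
proof -
  interpret B: group "BijGroup X" by (rule group_BijGroup)
  have t: "transposition_on X u v \<in> carrier (BijGroup X)" if "u \<in> X" "v \<in> X" for u v
    using transposition_on_finitary[OF that] by (simp add: finitary_perms_def)
  show ?thesis
    by (rule BijGroup_carrier_eqI)
      (use assms t in \<open>auto simp: BijGroup_apply transposition_on_apply Transposition.transpose_def\<close>)
qed

lemma transposition_on_not_commute:
  assumes "x \<in> X" "y \<in> X" "z \<in> X" "x \<noteq> y" "x \<noteq> z" "y \<noteq> z"
  shows "transposition_on X x z \<otimes>\<^bsub>BijGroup X\<^esub> transposition_on X x y \<noteq>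
    transposition_on X x y \<otimes>\<^bsub>BijGroup X\<^esub> transposition_on X x z"
proof
  have t: "transposition_on X u v \<in> carrier (BijGroup X)" if "u \<in> X" "v \<in> X" for u v
    using transposition_on_finitary[OF that] by (simp add: finitary_perms_def)
  assume "transposition_on X x z \<otimes>\<^bsub>BijGroup X\<^esub> transposition_on X x y =
    transposition_on X x y \<otimes>\<^bsub>BijGroup X\<^esub> transposition_on X x z"
  \<comment> \<open>At \<open>x\<close> the left product takes the value \<open>y\<close> and the
    right product the value \<open>z\<close>.\<close>
  from fun_cong[OF this, of x] show False
    using assms t by (simp add: BijGroup_apply transposition_on_apply Transposition.transpose_def)
qed

lemma conjugate_transposition_on:
  assumes "g \<in> carrier (BijGroup X)" "a \<in> X" "b \<in> X"
  shows "g \<otimes>\<^bsub>BijGroup X\<^esub> transposition_on X a b \<otimes>\<^bsub>BijGroup X\<^esub> inv\<^bsub>BijGroup X\<^esub> g =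
    transposition_on X (g a) (g b)"
proof -
  interpret B: group "BijGroup X" by (rule group_BijGroup)
  have t: "transposition_on X u v \<in> carrier (BijGroup X)" if "u \<in> X" "v \<in> X" for u v
    using transposition_on_finitary[OF that] by (simp add: finitary_perms_def)
  have gX: "g x \<in> X" if "x \<in> X" for x
    using assms(1) that by (rule BijGroup_carrier_mem)
  have inj: "g u = g v \<longleftrightarrow> u = v" if "u \<in> X" "v \<in> X" for u v
    using BijGroup_carrier_bij_betw[OF assms(1)] that by (metis bij_betw_imp_inj_on inj_onD)
  \<comment> \<open>Moving the inverse to the other side leaves an identity that can be checked
    pointwise, using injectivity of \<open>g\<close>.\<close>
  have "g \<otimes>\<^bsub>BijGroup X\<^esub> transposition_on X a b = transposition_on X (g a) (g b) \<otimes>\<^bsub>BijGroup X\<^esub> g"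
    by (rule BijGroup_carrier_eqI)
      (use assms t gX in \<open>auto simp: BijGroup_apply transposition_on_apply Transposition.transpose_def inj\<close>)
  then show ?thesis
    using assms t gX by (simp add: B.m_assoc)
qed

lemma openin_stabilizer_neighbourhood:
  assumes G: "subgroup G (BijGroup X)" "finitary_perms X \<subseteq> G" and "infinite X"
    and T: "t1_space T" "bracket_semi_topological_group (BijGroup X\<lparr>carrier := G\<rparr>) T"
    and x: "x \<in> X"
  obtains W where "openin T W" "\<one>\<^bsub>BijGroup X\<^esub> \<in> W" "\<And>g. g \<in> W \<Longrightarrow> g x = x"
proof -
  interpret B: group "BijGroup X" by (rule group_BijGroup)
  have sub: "G \<subseteq> carrier (BijGroup X)" using G(1) by (rule subgroup.subset)
  have inv_eq: "inv\<^bsub>BijGroup X\<lparr>carrier := G\<rparr>\<^esub> g = inv\<^bsub>BijGroup X\<^esub> g" if "g \<in> G" for g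
    using B.m_inv_consistent[OF G(1) that] .
  have tG: "transposition_on X u v \<in> G" if "u \<in> X" "v \<in> X" for u v
    using transposition_on_finitary[OF that] G(2) by blast
  \<comment> \<open>Four points besides \<open>x\<close> are chosen: \<open>z\<close>,
    \<open>z'\<close> for the conjugated transposition and \<open>y\<close>, \<open>y'\<close> for
    the fixed one.\<close>
  have "infinite (X - {x})" using \<open>infinite X\<close> by simp
  then obtain S where S: "S \<subseteq> X - {x}" "finite S" "card S = 4"
    by (meson infinite_arbitrarily_large)
  then obtain y y' z z' where S_eq: "S = {y, y', z, z'}"
    and d: "y \<noteq> y'" "y \<noteq> z" "y \<noteq> z'" "y' \<noteq> z" "y' \<noteq> z'" "z \<noteq> z'"
    by (auto simp: card_Suc_eq numeral_eq_Suc)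
  \<comment> \<open>This is the open set of \<open>openin_conjugate_not_commuting\<close> for the
    transpositions of \<open>x\<close> with \<open>v\<close> and of \<open>x\<close> with
    \<open>u\<close>, with the conjugate already computed.\<close>
  define N where "N = (\<lambda>v u. {g \<in> G.
    transposition_on X (g x) (g v) \<otimes>\<^bsub>BijGroup X\<^esub> transposition_on X x u \<noteq>
    transposition_on X x u \<otimes>\<^bsub>BijGroup X\<^esub> transposition_on X (g x) (g v)})"
  have "openin T (N v u)" if "u \<in> S" "v \<in> S" for u v
  proof -
    have uv: "u \<in> X" "v \<in> X" using S that by auto
    have "N v u = {g \<in> carrier (BijGroup X\<lparr>carrier := G\<rparr>).
        g \<otimes>\<^bsub>BijGroup X\<lparr>carrier := G\<rparr>\<^esub> transposition_on X x v
          \<otimes>\<^bsub>BijGroup X\<lparr>carrier := G\<rparr>\<^esub> inv\<^bsub>BijGroup X\<lparr>carrier := G\<rparr>\<^esub> g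
          \<otimes>\<^bsub>BijGroup X\<lparr>carrier := G\<rparr>\<^esub> transposition_on X x u \<noteq>
        transposition_on X x u \<otimes>\<^bsub>BijGroup X\<lparr>carrier := G\<rparr>\<^esub>
          (g \<otimes>\<^bsub>BijGroup X\<lparr>carrier := G\<rparr>\<^esub> transposition_on X x v
          \<otimes>\<^bsub>BijGroup X\<lparr>carrier := G\<rparr>\<^esub> inv\<^bsub>BijGroup X\<lparr>carrier := G\<rparr>\<^esub> g)}"
      unfolding N_def using sub x uv
      by (intro Collect_cong conj_cong) (auto simp: inv_eq conjugate_transposition_on subset_iff)
    also have "openin T \<dots>"
      by (rule openin_conjugate_not_commuting) (use T x uv tG in auto)
    finally show ?thesis .
  qed
  then have "openin T (N z y \<inter> N z y' \<inter> N z' y \<inter> N z' y')"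
    using S_eq by (intro openin_Int) auto
  moreover have "\<one>\<^bsub>BijGroup X\<^esub> \<in> N v u" if "u \<in> S" "v \<in> S" "u \<noteq> v" for u v
  proof -
    have uv: "u \<in> X" "v \<in> X" "x \<noteq> u" "x \<noteq> v" using S that by auto
    have "\<one>\<^bsub>BijGroup X\<^esub> w = w" if "w \<in> X" for w
      using that by (simp add: BijGroup_def)
    then show ?thesis
      unfolding N_def using uv x that transposition_on_not_commute[of x X u v] subgroup.one_closed[OF G(1)]
      by auto
  qed
  then have "\<one>\<^bsub>BijGroup X\<^esub> \<in> N z y \<inter> N z y' \<inter> N z' y \<inter> N z' y'"
    using S_eq d by auto
  moreover have "g x = x" if g: "g \<in> N z y \<inter> N z y' \<inter> N z' y \<inter> N z' y'" for g
  proof -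
    have gB: "g \<in> carrier (BijGroup X)" using g sub by (auto simp: N_def)
    have gX: "g w \<in> X" if "w \<in> X" for w
      using gB that by (rule BijGroup_carrier_mem)
    have inj: "g v = g w \<longleftrightarrow> v = w" if "v \<in> X" "w \<in> X" for v w
      using BijGroup_carrier_bij_betw[OF gB] that by (metis bij_betw_imp_inj_on inj_onD)
    \<comment> \<open>As neither pair is degenerate, this says that the two pairs share exactly one
      point.\<close>
    have meet: "{g x, g v} \<inter> {x, u} \<noteq> {} \<and> {g x, g v} \<noteq> {x, u}"
      if "g \<in> N v u" "u \<in> S" "v \<in> S" for u v
      using that transposition_on_commute[of "g x" X "g v" x u] gX x S by (auto simp: N_def)
    show ?thesis
    proof (rule ccontr)
      assume "g x \<noteq> x"
      then have "g x = u \<and> g v \<noteq> x \<or> g x \<noteq> u \<and> g v = x \<or> g v = u"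
        if "g \<in> N v u" "u \<in> S" "v \<in> S" for u v
        using meet[OF that] by blast
      \<comment> \<open>If \<open>g x = y\<close>, the conditions force both \<open>g z\<close> and
        \<open>g z'\<close> to be \<open>y'\<close>; if \<open>g x = y'\<close>, both are
        \<open>y\<close>; otherwise both are \<open>x\<close>. Each case contradicts injectivity of
        \<open>g\<close>.\<close>
      then have "g x = y \<and> g z \<noteq> x \<or> g x \<noteq> y \<and> g z = x \<or> g z = y"
        "g x = y' \<and> g z \<noteq> x \<or> g x \<noteq> y' \<and> g z = x \<or> g z = y'"
        "g x = y \<and> g z' \<noteq> x \<or> g x \<noteq> y \<and> g z' = x \<or> g z' = y"
        "g x = y' \<and> g z' \<noteq> x \<or> g x \<noteq> y' \<and> g z' = x \<or> g z' = y'"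
        using g S_eq by simp_all
      moreover have "g z \<noteq> g z'" "g z \<noteq> g x" "g z' \<noteq> g x"
        using inj[of z z'] inj[of z x] inj[of z' x] S S_eq x d by auto
      ultimately show False using \<open>y \<noteq> y'\<close> by metis
    qed
  qed
  ultimately show ?thesis by (rule that)
qed

section \<open>Comparison with an arbitrary T1 topology\<close>

lemma openin_point_evaluation:
  assumes G: "subgroup G (BijGroup X)" "finitary_perms X \<subseteq> G"
    and T: "t1_space T" "bracket_semi_topological_group (BijGroup X\<lparr>carrier := G\<rparr>) T"
    and x: "x \<in> X"
  shows "openin T {g \<in> G. g x = y}"
proof -
  interpret B: group "BijGroup X" by (rule group_BijGroup)
  have sub: "G \<subseteq> carrier (BijGroup X)" using G(1) by (rule subgroup.subset)
  have top: "topspace T = G"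
    using T(2) by (simp add: bracket_semi_topological_group_def)
  show ?thesis
  proof (cases "finite X")
    case True
    \<comment> \<open>There may be too few points for the stabilizer argument, but a finite T1 space
      is discrete.\<close>
    have "finite G"
      using finite_PiE[of X "\<lambda>_. X"] True subset_trans[OF sub BijGroup_carrier_subset_PiE]
      by (metis finite_subset)
    then have "T = discrete_topology G"
      using finite_t1_space_imp_discrete_topology[of T G] top T(1) by simp
    then show ?thesis by simp
  next
    case False
    then obtain W where W: "openin T W" "\<one>\<^bsub>BijGroup X\<^esub> \<in> W" "\<And>g. g \<in> W \<Longrightarrow> g x = x"
      using openin_stabilizer_neighbourhood[OF G _ T x] by metis
    have WG: "W \<subseteq> G" using openin_subset[OF W(1)] top by simp
    \<comment> \<open>The coset \<open>g W\<close> works: elements of \<open>W\<close> fix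
      \<open>x\<close>, so every element of the coset sends \<open>x\<close> to
      \<open>g x = y\<close>.\<close>
    have "\<exists>V. openin T V \<and> g \<in> V \<and> V \<subseteq> {g \<in> G. g x = y}" if "g \<in> G" "g x = y" for g
    proof (intro exI conjI)
      show "openin T ((\<lambda>h. g \<otimes>\<^bsub>BijGroup X\<^esub> h) ` W)"
        using bracket_semi_topological_group_openin_left_coset[OF T(2) W(1), of g] that by simp
      show "g \<in> (\<lambda>h. g \<otimes>\<^bsub>BijGroup X\<^esub> h) ` W"
        using W(2) that sub by (intro image_eqI[of _ _ "\<one>\<^bsub>BijGroup X\<^esub>"]) auto
      show "(\<lambda>h. g \<otimes>\<^bsub>BijGroup X\<^esub> h) ` W \<subseteq> {g \<in> G. g x = y}"
        using that WG sub x subgroup.m_closed[OF G(1)]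
        by (auto simp: BijGroup_apply W(3) subset_iff)
    qed
    then show ?thesis
      by (subst openin_subopen) blast
  qed
qed

theorem theorem4p2:
  fixes X :: "'a set" and G :: "('a \<Rightarrow> 'a) set"
  assumes "subgroup G (BijGroup X)"
    and "finitary_perms X \<subseteq> G"
  shows "t1_space (pointwise_topology X G) \<and>
    bracket_semi_topological_group (BijGroup X\<lparr>carrier := G\<rparr>) (pointwise_topology X G) \<and>
    (\<forall>T. t1_space T \<and> bracket_semi_topological_group (BijGroup X\<lparr>carrier := G\<rparr>) T \<longrightarrow>
      (\<forall>U. openin (pointwise_topology X G) U \<longrightarrow> openin T U))"
proof (intro conjI allI impI)
  show "t1_space (pointwise_topology X G)"
    by (rule t1_space_pointwise_topology)
  show "bracket_semi_topological_group (BijGroup X\<lparr>carrier := G\<rparr>) (pointwise_topology X G)"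
    using assms(1) by (rule bracket_semi_topological_group_pointwise_topology)
next
  fix T U
  assume T: "t1_space T \<and> bracket_semi_topological_group (BijGroup X\<lparr>carrier := G\<rparr>) T"
    and U: "openin (pointwise_topology X G) U"
  have sub: "G \<subseteq> carrier (BijGroup X)" using assms(1) by (rule subgroup.subset)
  have top: "topspace T = G"
    using T by (simp add: bracket_semi_topological_group_def)
  \<comment> \<open>Coarseness of the pointwise topology is continuity of the identity map out of
    \<open>T\<close>; the preimage of \<open>U\<close> under it is \<open>U\<close> itself.\<close>
  have "continuous_map T (pointwise_topology X G) (\<lambda>g. g)"
    using openin_point_evaluation[OF assms] T
    by (simp add: continuous_map_into_pointwise_topology[OF sub] top)
  from openin_continuous_map_preimage[OF this U]
  have "openin T {g \<in> G. g \<in> U}" using top by simp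
  moreover have "U \<subseteq> G"
    using openin_subset[OF U] topspace_pointwise_topology[OF sub] by simp
  then have "{g \<in> G. g \<in> U} = U" by blast
  ultimately show "openin T U" by simp
qed

end
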